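(* Let $\boldsymbol{u}=(\underbrace{u_1,\ldots,u_1}_{m_1},\underbrace{u_2,\ldots,u_2}_{m_2},\ldots,\underbrace{u_r,\ldots,u_r}_{m_r})$ with $1\le u_1<u_2<\cdots<u_r$ integers, where $u_j$ has multiplicity $m_j\ge 1$ for all $j\in[r]$. Then the number of $\boldsymbol{u}$-parking functions with exactly $k$ lucky cars is $$\left|\bigcup_{|I|=k}\mathsf{LuckyPF}_{\boldsymbol{u}}(I)\right|=\sum_{\substack{\kappa=(k_1,\ldots,k_r),\\ \sum_{i=1}^r k_i=k,\ 0\le k_i\le m_i}}\ \ \sum_{B=(B_1,\ldots,B_r)\in\mathcal{O}_{\boldsymbol{u}}}\binom{m_1}{k_1}(u_1-1)^{m_1-k_1}\,S(B;\kappa),$$ where $$S(B;\kappa)=\sum_{\substack{(L_2,L_3,\ldots,L_r),\\ L_d\subseteq B_d,\ |L_d|=k_d}}\ \prod_{j=2}^{r}\ \prod_{t=1}^{j}(u_j-u_{t-1}-1)^{\ell_{j,t}-\ell_{j,t-1}}$$ and $u_0=0$.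
   Context: Notation: $[N]=\{1,\dots,N\}$, $\mathbb{N}=\{1,2,\dots\}$; let $n=m_1+\cdots+m_r$. The convention $0^0=1$ is used. Spot $i\in\mathbb{N}$ on a one-way street has capacity equal to the number of times $i$ occurs in $\boldsymbol{u}$ (so spot $u_j$ has capacity $m_j$ and all other spots have capacity 0). Cars $1,\dots,n$ enter in this order with preferences $\boldsymbol{a}=(a_1,\dots,a_n)\in\mathbb{N}^n$; car $c$ parks in the first spot $p\ge a_c$ in which the number of cars already parked is less than the capacity of $p$, and fails to park if there is none. $\boldsymbol{a}$ is a $\boldsymbol{u}$-parking function if all cars park. A car is lucky if it parks in its preferred spot. For $I\subseteq[n]$, $\mathsf{LuckyPF}_{\boldsymbol{u}}(I)$ is the set of $\boldsymbol{u}$-parking functions whose set of lucky cars is exactly $I$. In this statement, outcomes are recorded without unavailable spots: the outcome of a $\boldsymbol{u}$-parking function is the ordered set partition $B=(B_1,\dots,B_r)$ of $[n]$ with $|B_j|=m_j$, where $B_j$ is the set of cars parked in spot $u_j$; $\mathcal{O}_{\boldsymbol{u}}$ is the set of all outcomes of $\boldsymbol{u}$-parking functions. Given $B$, $\kappa=(k_1,\dots,k_r)$, and sets $L_j\subseteq B_j$ with $|L_j|=k_j$ ($L_j$ being the set of lucky cars in $B_j$), define for $0<t<j$ the number $\ell_{j,t}$ to be the number of unlucky cars in $B_j$ (elements of $B_j\setminus L_j$) such that when they park, spots $u_t,u_{t+1},\dots,u_{j-1}$ are completely occupied, equivalently $$\ell_{j,t}=\Big|\Big\{b\in B_j\setminus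 L_j: b>\max\Big(\bigcup_{d=t}^{j-1}B_d\Big)\Big\}\Big| .$$ Also $\ell_{j,j}=|B_j\setminus L_j|=m_j-k_j$ and $\ell_{j,0}=0$. *)

theory Defs
  imports "HOL-Library.FuncSet"
begin

text \<open>
  Preferences and parking assignments are indexed by the cars \<open>1, 2, \<dots>\<close>. The vector
  \<open>us\<close> gives the capacities: spot \<open>p\<close> has capacity \<open>count_list us p\<close>.
\<close>

text \<open>
  The assignment of cars to spots after cars \<open>1, \<dots>, c\<close> have entered. A car mapped to
  \<open>None\<close> has not entered yet or has failed to park.
\<close>

primrec parking :: "nat list \<Rightarrow> (nat \<Rightarrow> nat) \<Rightarrow> nat \<Rightarrow> (nat \<rightharpoonup> nat)" where
  "parking us a 0 = Map.empty"
| "parking us a (Suc c) =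
    (let s = parking us a c;
         free = (\<lambda>p. a (Suc c) \<le> p \<and> card {d. s d = Some p} < count_list us p)
     in if \<exists>p. free p then s(Suc c \<mapsto> (LEAST p. free p)) else s)"

definition parking_functions :: "nat list \<Rightarrow> (nat \<Rightarrow> nat) set" where
  "parking_functions us =
    {a \<in> {1..length us} \<rightarrow>\<^sub>E {1..}. \<forall>c\<in>{1..length us}. parking us a (length us) c \<noteq> None}"

definition lucky_cars :: "nat list \<Rightarrow> (nat \<Rightarrow> nat) \<Rightarrow> nat set" where
  "lucky_cars us a = {c \<in> {1..length us}. parking us a (length us) c = Some (a c)}"

definition LuckyPF :: "nat list \<Rightarrow> nat set \<Rightarrow> (nat \<Rightarrow> nat) set" where
  "LuckyPF us I = {a \<in> parking_functions us. lucky_cars us a = I}"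

text \<open>
  The vector in which the entry \<open>u j\<close> is repeated \<open>m j\<close> times, for \<open>j = 1, \<dots>, r\<close>.
\<close>

definition capacity_vector :: "nat \<Rightarrow> (nat \<Rightarrow> nat) \<Rightarrow> (nat \<Rightarrow> nat) \<Rightarrow> nat list" where
  "capacity_vector r u m = concat (map (\<lambda>j. replicate (m j) (u j)) [1..<Suc r])"

text \<open>
  Unavailable spots are left out of an outcome: its \<open>j\<close>-th block is the set of cars
  parked in spot \<open>u j\<close>.
\<close>

definition outcome ::
  "nat \<Rightarrow> (nat \<Rightarrow> nat) \<Rightarrow> (nat \<Rightarrow> nat) \<Rightarrow> (nat \<Rightarrow> nat) \<Rightarrow> (nat \<Rightarrow> nat set)" where
  "outcome r u m a =
    (let us = capacity_vector r u m
     in (\<lambda>j\<in>{1..r}. {c \<in> {1..length us}. parking us a (length us) c = Some (u j)}))"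

definition outcomes :: "nat \<Rightarrow> (nat \<Rightarrow> nat) \<Rightarrow> (nat \<Rightarrow> nat) \<Rightarrow> (nat \<Rightarrow> nat set) set" where
  "outcomes r u m = outcome r u m ` parking_functions (capacity_vector r u m)"

text \<open>
  For \<open>0 < t < j\<close>, the number of unlucky cars in block \<open>j\<close> that arrive after the
  spots of the blocks \<open>t, \<dots>, j - 1\<close> have been filled.
\<close>

definition ell :: "(nat \<Rightarrow> nat set) \<Rightarrow> (nat \<Rightarrow> nat set) \<Rightarrow> nat \<Rightarrow> nat \<Rightarrow> nat" where
  "ell B L j t =
    (if t = 0 then 0
     else if t = j then card (B j - L j)
     else card {b \<in> B j - L j. b > Max (\<Union>d\<in>{t..<j}. B d)})"

text \<open>
  The subtractions on natural numbers below do not truncate for \<open>B\<close> an outcome and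
  \<open>0 = u 0 < u 1 < \<dots> < u r\<close>: \<open>u (t - 1) < u j\<close> for \<open>1 \<le> t \<le> j\<close>, and \<open>ell B L j t\<close>
  is nondecreasing in \<open>t \<le> j\<close>.
\<close>

definition lucky_weight ::
  "nat \<Rightarrow> (nat \<Rightarrow> nat) \<Rightarrow> (nat \<Rightarrow> nat set) \<Rightarrow> (nat \<Rightarrow> nat) \<Rightarrow> nat" where
  "lucky_weight r u B \<kappa> =
    (\<Sum>L \<in> (\<Pi>\<^sub>E d\<in>{2..r}. {X. X \<subseteq> B d \<and> card X = \<kappa> d}).
       \<Prod>j=2..r. \<Prod>t=1..j. (u j - u (t - 1) - 1) ^ (ell B L j t - ell B L j (t - 1)))"

end

theory Submission
  imports Defs "HOL-Library.Disjoint_Sets"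
begin

text \<open>
  Fix an outcome \<open>B\<close>. Which cars have filled a given spot when car \<open>c\<close> enters depends only on
  \<open>B\<close> and \<open>c\<close>, so the preferences that lead to \<open>B\<close> can be chosen car by car: a car \<open>c\<close> of block
  \<open>j\<close> may prefer any spot from which it rolls on to \<open>u j\<close>, that is, any spot after the last spot
  before \<open>u j\<close> that still has room. If this last open spot is \<open>u (t - 1)\<close>, with \<open>u 0 = 0\<close>
  standing for the case that there is none, then \<open>t\<close> is the least index for which the blocks
  \<open>t, \<dots>, j - 1\<close> are full when \<open>c\<close> enters; it is called the barrier of \<open>c\<close>. The car is lucky for
  one of these preferences, namely \<open>u j\<close>, and unlucky for the other \<open>u j - u (t - 1) - 1\<close>. This
  description of the preferences as a product set is \<open>parking_functions_with_outcome\<close>.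

  Hence the preferences with outcome \<open>B\<close> and lucky sets \<open>L j \<subseteq> B j\<close> are counted by the product of
  \<open>u j - u (t - 1) - 1\<close> over all unlucky cars (\<open>card_fixed_lucky_blocks\<close>). Grouping the unlucky
  cars of block \<open>j\<close> by their barrier gives the powers in the weight: \<open>ell B L j t\<close> counts the
  unlucky cars with barrier at most \<open>t\<close>, so the difference of two consecutive values counts those
  with barrier exactly \<open>t\<close> (\<open>prod_ell_eq_unlucky_choices\<close>).

  Finally, since the factor of block \<open>j\<close> depends on \<open>L j\<close> only, the sum over all choices of \<open>L\<close>
  with prescribed cardinalities is a product of sums, one per block. In the first block every
  barrier is 1, which turns its sum into \<open>(m 1 choose \<kappa> 1) * (u 1 - 1) ^ (m 1 - \<kappa> 1)\<close>.
\<close>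

section \<open>Capacities\<close>

lemma length_capacity_vector: "length (capacity_vector r u m) = (\<Sum>j=1..r. m j)"
  by (induction r) (simp_all add: capacity_vector_def)

lemma count_list_replicate: "count_list (replicate k x) y = (if x = y then k else 0)"
  by (induction k) auto

lemma count_list_capacity_vector:
  "count_list (capacity_vector r u m) p = (\<Sum>j=1..r. if u j = p then m j else 0)"
  by (induction r) (simp_all add: capacity_vector_def count_list_replicate)

lemma count_list_capacity_vector_spot:
  assumes "inj_on u {1..r}" "j \<in> {1..r}"
  shows "count_list (capacity_vector r u m) (u j) = m j"
proof -
  have "count_list (capacity_vector r u m) (u j) = (\<Sum>i\<in>{1..r}. if i = j then m i else 0)"
    unfolding count_list_capacity_vector
    using assms by (intro sum.cong) (auto dest: inj_onD)
  then show ?thesis using assms by simp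
qed

lemma count_list_capacity_vector_unavailable:
  assumes "p \<notin> u ` {1..r}"
  shows "count_list (capacity_vector r u m) p = 0"
  unfolding count_list_capacity_vector using assms by (intro sum.neutral) auto


section \<open>The parking process\<close>

lemma parking_Suc_other:
  assumes "d \<noteq> Suc c"
  shows "parking us a (Suc c) d = parking us a c d"
proof -
  have *: "(if P then s(Suc c \<mapsto> y) else s) d = s d" for P y and s :: "nat \<rightharpoonup> nat"
    using assms by simp
  show ?thesis unfolding parking.simps(2) Let_def by (rule *)
qed

lemma parking_eq_None: "d \<notin> {1..c} \<Longrightarrow> parking us a c d = None"
proof (induction c)
  case (Suc c)
  then have "d \<noteq> Suc c" "d \<notin> {1..c}" by auto
  then show ?case using Suc.IH parking_Suc_other by metis
qed simp

lemma finite_parked: "finite {d. parking us a c d = Some p}"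
proof (rule finite_subset)
  show "{d. parking us a c d = Some p} \<subseteq> {1..c}"
  proof
    fix d assume "d \<in> {d. parking us a c d = Some p}"
    then show "d \<in> {1..c}"
      using parking_eq_None[of d c us a] by (cases "d \<in> {1..c}") simp_all
  qed
qed simp

text \<open>
  The form of the parking rule that is used below: the least available spot is described by its
  own availability and the lack of room in all earlier ones.
\<close>

lemma parking_Suc_self:
  "parking us a (Suc c) (Suc c) = Some q \<longleftrightarrow>
     a (Suc c) \<le> q \<and> card {d. parking us a c d = Some q} < count_list us q \<and>
     (\<forall>p. a (Suc c) \<le> p \<and> p < q \<longrightarrow> count_list us p \<le> card {d. parking us a c d = Some p})"
proof -
  define free where
    "free = (\<lambda>p. a (Suc c) \<le> p \<and> card {d. parking us a c d = Some p} < count_list us p)"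
  have "parking us a (Suc c) (Suc c) = (if \<exists>p. free p then Some (LEAST p. free p) else None)"
    unfolding parking.simps(2) Let_def free_def[symmetric]
    using parking_eq_None[of "Suc c" c us a] by simp
  also have "\<dots> = Some q \<longleftrightarrow> free q \<and> (\<forall>p<q. \<not> free p)"
  proof (cases "\<exists>p. free p")
    case True
    then have "free (LEAST p. free p)" "\<And>p. p < (LEAST p. free p) \<Longrightarrow> \<not> free p"
      using LeastI_ex not_less_Least by blast+
    moreover have "(LEAST p. free p) = q" if "free q" "\<forall>p<q. \<not> free p"
      using that by (intro Least_equality) (auto simp: not_less[symmetric])
    ultimately show ?thesis using True by (metis option.inject)
  next
    case False
    then show ?thesis by simp
  qed
  finally show ?thesis unfolding free_def by (metis not_less)
qed

lemma parking_capacity: "card {d. parking us a c d = Some p} \<le> count_list us p"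
proof (induction c)
  case 0
  then show ?case by simp
next
  case (Suc c)
  show ?case
  proof (cases "parking us a (Suc c) (Suc c) = Some p")
    case True
    have "{d. parking us a (Suc c) d = Some p} \<subseteq> insert (Suc c) {d. parking us a c d = Some p}"
      using parking_Suc_other by fastforce
    then have "card {d. parking us a (Suc c) d = Some p}
        \<le> card (insert (Suc c) {d. parking us a c d = Some p})"
      using finite_parked by (intro card_mono) auto
    also have "\<dots> \<le> Suc (card {d. parking us a c d = Some p})" by (rule card_insert_le_m1) auto
    also have "\<dots> \<le> count_list us p" using True unfolding parking_Suc_self by simp
    finally show ?thesis .
  next
    case False
    then have "{d. parking us a (Suc c) d = Some p} \<subseteq> {d. parking us a c d = Some p}"
      using parking_Suc_other by (metis (mono_tags, lifting) Collect_mono)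
    then show ?thesis using Suc card_mono[OF finite_parked] order_trans by blast
  qed
qed

lemma parking_spot_available: "parking us a c d = Some p \<Longrightarrow> count_list us p \<noteq> 0"
  using parking_capacity[of us a c p] finite_parked[of us a c p]
  by (metis (mono_tags, lifting) card_0_eq empty_iff le_zero_eq mem_Collect_eq)

text \<open>
  A car never moves after it has parked. Therefore a prescribed assignment \<open>f\<close> arises if and only
  if each car makes the right step on its own, where the state that it meets can be read off from
  \<open>f\<close>. This removes the recursion: the conditions on the preferences of different cars are
  independent.
\<close>

lemma parking_eq_iff:
  "(\<forall>c\<in>{1..n}. parking us a n c = Some (f c)) \<longleftrightarrow>
   (\<forall>c\<in>{1..n}. a c \<le> f c \<and> card {d \<in> {1..<c}. f d = f c} < count_list us (f c) \<and>
      (\<forall>p. a c \<le> p \<and> p < f c \<longrightarrow> count_list us p \<le> card {d \<in> {1..<c}. f d = p}))"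
proof (induction n)
  case 0
  then show ?case by simp
next
  case (Suc n)
  have split: "(\<forall>c\<in>{1..Suc n}. P c) \<longleftrightarrow> (\<forall>c\<in>{1..n}. P c) \<and> P (Suc n)" for P
    using atLeastAtMostSuc_conv[of 1 n] by auto
  have old: "(\<forall>c\<in>{1..n}. parking us a (Suc n) c = Some (f c)) \<longleftrightarrow>
        (\<forall>c\<in>{1..n}. parking us a n c = Some (f c))"
    by (intro ball_cong) (auto simp: parking_Suc_other simp del: parking.simps)
  show ?case
  proof (cases "\<forall>c\<in>{1..n}. parking us a n c = Some (f c)")
    case True
    have "parking us a n d = Some p \<longleftrightarrow> d \<in> {1..<Suc n} \<and> f d = p" for d p
      unfolding atLeastLessThanSuc_atLeastAtMost
      using True parking_eq_None[of d n us a] by (cases "d \<in> {1..n}") fastforce+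
    then have "{d. parking us a n d = Some p} = {d \<in> {1..<Suc n}. f d = p}" for p
      by blast
    then show ?thesis using True Suc.IH old unfolding split parking_Suc_self by simp
  next
    case False
    then show ?thesis using Suc.IH old unfolding split by blast
  qed
qed


section \<open>Parking functions with a given outcome\<close>

lemma extensional_eq_iff:
  "f \<in> extensional A \<Longrightarrow> g \<in> extensional A \<Longrightarrow> f = g \<longleftrightarrow> (\<forall>x\<in>A. f x = g x)"
  by (metis extensionalityI)

text \<open>
  For a car \<open>c\<close> of block \<open>j\<close>, all cars of block \<open>i\<close> precede \<open>c\<close> if and only if spot \<open>u i\<close> is
  full when \<open>c\<close> enters. The value \<open>j\<close> is reached if spot \<open>u (j - 1)\<close> still has room, and the
  value 1 if all spots before \<open>u j\<close> are full.
\<close>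

definition barrier :: "(nat \<Rightarrow> nat set) \<Rightarrow> nat \<Rightarrow> nat \<Rightarrow> nat" where
  "barrier B j c = (LEAST t. 1 \<le> t \<and> (\<forall>i\<in>{t..<j}. \<forall>d\<in>B i. d < c))"

lemma barrier_works:
  assumes "1 \<le> j"
  shows "1 \<le> barrier B j c \<and> (\<forall>i\<in>{barrier B j c..<j}. \<forall>d\<in>B i. d < c)"
  unfolding barrier_def
  by (rule LeastI[where P = "\<lambda>t. 1 \<le> t \<and> (\<forall>i\<in>{t..<j}. \<forall>d\<in>B i. d < c)" and k = j])
    (use assms in simp)

lemma barrier_le_iff:
  assumes "1 \<le> t" "t \<le> j"
  shows "barrier B j c \<le> t \<longleftrightarrow> (\<forall>i\<in>{t..<j}. \<forall>d\<in>B i. d < c)"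
proof
  assume "barrier B j c \<le> t"
  then have "{t..<j} \<subseteq> {barrier B j c..<j}" by auto
  then show "\<forall>i\<in>{t..<j}. \<forall>d\<in>B i. d < c"
    using barrier_works[of j B c] assms by (meson order_trans subsetD)
next
  assume "\<forall>i\<in>{t..<j}. \<forall>d\<in>B i. d < c"
  then show "barrier B j c \<le> t" unfolding barrier_def by (intro Least_le conjI assms(1))
qed

lemma barrier_bounds:
  assumes "1 \<le> j"
  shows "1 \<le> barrier B j c" "barrier B j c \<le> j"
  using barrier_works[OF assms, of B c] barrier_le_iff[of j j B c] assms by auto

text \<open>
  The assumptions on \<open>B\<close> are the properties of outcomes that the count needs; every outcome has
  them by \<open>outcome_blocks_outcome\<close> below. Extending the strict monotonicity of \<open>u\<close> to the index 0
  makes \<open>u 0 = 0\<close> a spot in front of the street, so that barrier 1 is no special case.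
\<close>

locale outcome_blocks =
  fixes r :: nat and u m :: "nat \<Rightarrow> nat" and B :: "nat \<Rightarrow> nat set"
  assumes u_0: "u 0 = 0"
    and u_strict_mono: "strict_mono_on {0..r} u"
    and m_pos: "j \<in> {1..r} \<Longrightarrow> 1 \<le> m j"
    and block_union: "(\<Union>j\<in>{1..r}. B j) = {1..\<Sum>j=1..r. m j}"
    and block_disjoint: "disjoint_family_on B {1..r}"
    and card_block: "j \<in> {1..r} \<Longrightarrow> card (B j) = m j"
    and block_extensional: "B \<in> extensional {1..r}"
begin

abbreviation "us \<equiv> capacity_vector r u m"

abbreviation "cars \<equiv> {1..\<Sum>j=1..r. m j}"

definition block_of :: "nat \<Rightarrow> nat" where
  "block_of c = (THE j. j \<in> {1..r} \<and> c \<in> B j)"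

lemma u_less_iff: "i \<le> r \<Longrightarrow> j \<le> r \<Longrightarrow> u i < u j \<longleftrightarrow> i < j"
  using strict_mono_on_less[OF u_strict_mono] by simp

lemma u_inj: "inj_on u {1..r}"
  by (rule inj_on_subset[OF strict_mono_on_imp_inj_on[OF u_strict_mono]]) auto

lemma finite_block: "j \<in> {1..r} \<Longrightarrow> finite (B j)"
  using card_block m_pos by (metis card.infinite not_one_le_zero)

lemma block_nonempty: "j \<in> {1..r} \<Longrightarrow> B j \<noteq> {}"
  using card_block m_pos by (metis card.empty not_one_le_zero)

lemma block_of_eq: "j \<in> {1..r} \<Longrightarrow> c \<in> B j \<Longrightarrow> block_of c = j"
  unfolding block_of_def using block_disjoint
  by (intro the_equality) (blast, unfold disjoint_family_on_def, blast)

lemma block_ofE: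
  assumes "c \<in> cars"
  obtains "block_of c \<in> {1..r}" "c \<in> B (block_of c)"
  using assms block_of_eq unfolding block_union[symmetric] by blast

lemma mem_block_iff: "j \<in> {1..r} \<Longrightarrow> c \<in> B j \<longleftrightarrow> c \<in> cars \<and> block_of c = j"
  using block_of_eq block_union block_ofE by blast

lemma all_cars_iff: "(\<forall>c\<in>cars. P c (block_of c)) \<longleftrightarrow> (\<forall>j\<in>{1..r}. \<forall>c\<in>B j. P c j)"
  using mem_block_iff block_ofE by metis

text \<open>
  The preferences with which a car \<open>c\<close> ends up in block \<open>j\<close>, given that the blocks are filled
  according to \<open>B\<close>.
\<close>

definition acceptable :: "nat \<Rightarrow> nat \<Rightarrow> nat set" where
  "acceptable j c = {u (barrier B j c - 1)<..u j}"

lemma parked_in_block: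
  assumes "c \<in> cars" "j \<in> {1..r}"
  shows "{d \<in> {1..<c}. u (block_of d) = u j} = {d \<in> B j. d < c}"
proof -
  have "d \<in> B j" if "d < c" "1 \<le> d" "u (block_of d) = u j" for d
  proof -
    have d: "d \<in> cars" using that assms by auto
    then show ?thesis
      using that block_ofE[OF d] inj_onD[OF u_inj that(3)] assms by metis
  qed
  then show ?thesis using mem_block_iff[OF assms(2)] by auto
qed

text \<open>
  Car \<open>c\<close> rolls from \<open>p\<close> to \<open>u j\<close> if every spot \<open>u i\<close> on its way is full. As the spots are
  ordered, this says that \<open>p\<close> lies beyond the last one that is not full, which is
  \<open>u (barrier B j c - 1)\<close>.
\<close>

lemma acceptable_iff:
  assumes j: "j \<in> {1..r}" and p: "1 \<le> p"
  shows "p \<in> acceptable j c \<longleftrightarrow>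
    p \<le> u j \<and> (\<forall>i\<in>{1..<j}. p \<le> u i \<longrightarrow> (\<forall>d\<in>B i. d < c))"
proof -
  define t where "t = barrier B j c"
  have t: "1 \<le> t" "t \<le> j" using barrier_bounds j unfolding t_def by auto
  have below: "\<forall>i\<in>{t..<j}. \<forall>d\<in>B i. d < c"
    using barrier_le_iff[OF t, of B c] unfolding t_def by blast
  have "u (t - 1) < p \<longleftrightarrow> (\<forall>i\<in>{1..<j}. p \<le> u i \<longrightarrow> (\<forall>d\<in>B i. d < c))"
  proof
    assume p': "u (t - 1) < p"
    show "\<forall>i\<in>{1..<j}. p \<le> u i \<longrightarrow> (\<forall>d\<in>B i. d < c)"
    proof (intro ballI impI)
      fix i d assume i: "i \<in> {1..<j}" "p \<le> u i" and "d \<in> B i"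
      then have "u (t - 1) < u i" using p' by simp
      then have "t - 1 < i" using u_less_iff[of "t - 1" i] i t j by auto
      then show "d < c" using below i \<open>d \<in> B i\<close> by auto
    qed
  next
    assume full: "\<forall>i\<in>{1..<j}. p \<le> u i \<longrightarrow> (\<forall>d\<in>B i. d < c)"
    show "u (t - 1) < p"
    proof (rule ccontr)
      assume "\<not> u (t - 1) < p"
      then have le: "p \<le> u (t - 1)" by simp
      \<comment> \<open>The spot \<open>u (t - 1)\<close> is a real one, and the blocks from \<open>t - 1\<close> on are full,
        against the minimality of the barrier.\<close>
      then have t1: "1 \<le> t - 1" using p u_0 by (cases "t - 1") auto
      have "\<forall>i\<in>{t - 1..<j}. \<forall>d\<in>B i. d < c"
      proof
        fix i assume i: "i \<in> {t - 1..<j}"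
        then have "u (t - 1) \<le> u i"
          using u_less_iff[of i "t - 1"] t j by (auto simp: not_less[symmetric])
        then have "p \<le> u i" using le by simp
        moreover have "i \<in> {1..<j}" using i t1 by simp
        ultimately show "\<forall>d\<in>B i. d < c" using full by blast
      qed
      then have "t \<le> t - 1" using barrier_le_iff[of "t - 1" j B c] t1 t t_def by simp
      then show False using t by simp
    qed
  qed
  then show ?thesis unfolding acceptable_def t_def by auto
qed

lemma acceptable_pos: "p \<in> acceptable j c \<Longrightarrow> 1 \<le> p"
  unfolding acceptable_def by auto

lemma spot_acceptable: "j \<in> {1..r} \<Longrightarrow> u j \<in> acceptable j c"
  using barrier_bounds[of j B c] u_less_iff[of "barrier B j c - 1" j]
  unfolding acceptable_def by auto

text \<open>
  In the conditions of \<open>parking_eq_iff\<close>, there is always room for \<open>c\<close> in its own block, because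
  the cars of this block that precede \<open>c\<close> are fewer than \<open>m j\<close>. Spots of capacity 0 never stop a
  car, and a spot \<open>u i\<close> is full once the whole block \<open>i\<close> has entered. What remains is the condition
  of \<open>acceptable_iff\<close>.
\<close>

lemma parking_blocks_iff:
  assumes "\<forall>c\<in>cars. 1 \<le> a c"
  shows "(\<forall>c\<in>cars. parking us a (\<Sum>j=1..r. m j) c = Some (u (block_of c))) \<longleftrightarrow>
         (\<forall>c\<in>cars. a c \<in> acceptable (block_of c) c)"
  unfolding parking_eq_iff
proof (rule ball_cong[OF refl])
  fix c assume c: "c \<in> cars"
  define j where "j = block_of c"
  have j: "j \<in> {1..r}" "c \<in> B j" using block_ofE[OF c] j_def by auto
  have free: "card {d \<in> {1..<c}. u (block_of d) = u j} < count_list us (u j)"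
  proof -
    have "{d \<in> B j. d < c} \<subset> B j" using j by auto
    then have "card {d \<in> B j. d < c} < m j"
      using psubset_card_mono[OF finite_block] card_block j by metis
    then show ?thesis
      using count_list_capacity_vector_spot[OF u_inj] parked_in_block c j by simp
  qed
  have full: "count_list us (u i) \<le> card {d \<in> {1..<c}. u (block_of d) = u i} \<longleftrightarrow>
      (\<forall>d\<in>B i. d < c)" if i: "i \<in> {1..r}" for i
  proof -
    have "card (B i) \<le> card {d \<in> B i. d < c} \<longleftrightarrow> {d \<in> B i. d < c} = B i"
    proof
      assume "card (B i) \<le> card {d \<in> B i. d < c}"
      then show "{d \<in> B i. d < c} = B i" by (intro card_seteq finite_block i) blast
    qed simp
    also have "\<dots> \<longleftrightarrow> (\<forall>d\<in>B i. d < c)" by blast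
    finally show ?thesis
      unfolding count_list_capacity_vector_spot[OF u_inj i] parked_in_block[OF c i] card_block[OF i] .
  qed
  have "(\<forall>p. a c \<le> p \<and> p < u j \<longrightarrow>
           count_list us p \<le> card {d \<in> {1..<c}. u (block_of d) = p}) \<longleftrightarrow>
        (\<forall>i\<in>{1..<j}. a c \<le> u i \<longrightarrow> (\<forall>d\<in>B i. d < c))" (is "?L \<longleftrightarrow> ?R")
  proof
    assume L: ?L
    show ?R
    proof (intro ballI impI)
      fix i d assume i: "i \<in> {1..<j}" "a c \<le> u i" "d \<in> B i"
      then have "u i < u j" "i \<in> {1..r}" using u_less_iff[of i j] j by auto
      then show "d < c" using L i full by blast
    qed
  next
    assume R: ?R
    show ?L
    proof (intro allI impI)
      fix p assume p: "a c \<le> p \<and> p < u j"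
      show "count_list us p \<le> card {d \<in> {1..<c}. u (block_of d) = p}"
      proof (cases "p \<in> u ` {1..r}")
        case True
        then obtain i where i: "i \<in> {1..r}" "p = u i" by auto
        then have "i < j" using p u_less_iff[of i j] j by auto
        then show ?thesis using R i p full by auto
      next
        case False
        then show ?thesis using count_list_capacity_vector_unavailable by simp
      qed
    qed
  qed
  then show "(a c \<le> u (block_of c) \<and>
      card {d \<in> {1..<c}. u (block_of d) = u (block_of c)} < count_list us (u (block_of c)) \<and>
      (\<forall>p. a c \<le> p \<and> p < u (block_of c) \<longrightarrow>
         count_list us p \<le> card {d \<in> {1..<c}. u (block_of d) = p})) \<longleftrightarrow>
      a c \<in> acceptable (block_of c) c"
    using free acceptable_iff[OF j(1), of "a c" c] assms c unfolding j_def by auto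
qed

lemma outcome_eq_iff:
  assumes "a \<in> parking_functions us"
  shows "outcome r u m a = B \<longleftrightarrow>
    (\<forall>c\<in>cars. parking us a (\<Sum>j=1..r. m j) c = Some (u (block_of c)))"
proof
  assume B: "outcome r u m a = B"
  show "\<forall>c\<in>cars. parking us a (\<Sum>j=1..r. m j) c = Some (u (block_of c))"
  proof
    fix c assume "c \<in> cars"
    then have "block_of c \<in> {1..r}" "c \<in> outcome r u m a (block_of c)"
      using B block_ofE by auto
    then show "parking us a (\<Sum>j=1..r. m j) c = Some (u (block_of c))"
      unfolding outcome_def by (simp add: length_capacity_vector Let_def)
  qed
next
  assume P: "\<forall>c\<in>cars. parking us a (\<Sum>j=1..r. m j) c = Some (u (block_of c))"
  show "outcome r u m a = B"
  proof (rule extensionalityI[of _ "{1..r}"])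
    fix j assume j: "j \<in> {1..r}"
    have "u (block_of c) = u j \<longleftrightarrow> block_of c = j" if "c \<in> cars" for c
      using inj_on_eq_iff[OF u_inj _ j] block_ofE[OF that] by metis
    then have "{c \<in> cars. parking us a (\<Sum>j=1..r. m j) c = Some (u j)} = B j"
      using P mem_block_iff[OF j] by auto
    then show "outcome r u m a j = B j"
      using j by (simp add: outcome_def length_capacity_vector Let_def)
  qed (use block_extensional in \<open>auto simp: outcome_def Let_def\<close>)
qed

text \<open>
  The parking functions with outcome \<open>B\<close> form a product set, so that they can be counted
  one car at a time.
\<close>

lemma parking_functions_with_outcome:
  "{a \<in> parking_functions us. outcome r u m a = B} =
     (\<Pi>\<^sub>E c\<in>cars. acceptable (block_of c) c)" (is "?F = ?P")
proof (rule set_eqI)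
  fix a
  show "a \<in> ?F \<longleftrightarrow> a \<in> ?P"
  proof
    assume a: "a \<in> ?F"
    then have ext: "a \<in> cars \<rightarrow>\<^sub>E {1..}"
      by (simp add: parking_functions_def length_capacity_vector)
    then have "\<forall>c\<in>cars. a c \<in> acceptable (block_of c) c"
      using a parking_blocks_iff[of a] outcome_eq_iff[of a] by fastforce
    then show "a \<in> ?P" using ext by (simp add: PiE_iff)
  next
    assume a: "a \<in> ?P"
    then have pos: "\<forall>c\<in>cars. 1 \<le> a c" using acceptable_pos by (auto simp: PiE_iff)
    have P: "\<forall>c\<in>cars. parking us a (\<Sum>j=1..r. m j) c = Some (u (block_of c))"
      using a parking_blocks_iff[OF pos] by (simp add: PiE_iff)
    then have "a \<in> parking_functions us"
      using pos a by (auto simp: parking_functions_def length_capacity_vector PiE_iff)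
    then show "a \<in> ?F" using P outcome_eq_iff by simp
  qed
qed

definition lucky_blocks :: "(nat \<Rightarrow> nat) \<Rightarrow> nat \<Rightarrow> nat set" where
  "lucky_blocks a = (\<lambda>j\<in>{1..r}. {c \<in> B j. a c = u j})"

lemma lucky_blocks_extensional: "lucky_blocks a \<in> extensional {1..r}"
  unfolding lucky_blocks_def by simp

lemma card_lucky_cars:
  assumes "a \<in> parking_functions us" "outcome r u m a = B"
  shows "card (lucky_cars us a) = (\<Sum>j=1..r. card (lucky_blocks a j))"
proof -
  have "parking us a (\<Sum>j=1..r. m j) c = Some (u (block_of c))" if "c \<in> cars" for c
    using assms outcome_eq_iff that by blast
  then have "lucky_cars us a = {c \<in> cars. a c = u (block_of c)}"
    by (auto simp: lucky_cars_def length_capacity_vector)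
  also have "\<dots> = (\<Union>j\<in>{1..r}. lucky_blocks a j)"
  proof -
    have "c \<in> cars \<and> a c = u (block_of c) \<longleftrightarrow> (\<exists>j\<in>{1..r}. c \<in> B j \<and> a c = u j)" for c
      using mem_block_iff[of _ c] block_ofE[of c] by blast
    then show ?thesis by (auto simp: lucky_blocks_def)
  qed
  also have "card \<dots> = (\<Sum>j=1..r. card (lucky_blocks a j))"
    using finite_block block_disjoint
    by (intro card_UN_disjoint) (auto simp: lucky_blocks_def disjoint_family_on_def)
  finally show ?thesis .
qed

text \<open>
  The number of ways to choose preferences for the unlucky cars of block \<open>j\<close> if \<open>X\<close> is its set of
  lucky cars: such a car may use any acceptable preference other than \<open>u j\<close>.
\<close>

definition unlucky_choices :: "nat \<Rightarrow> nat set \<Rightarrow> nat" where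
  "unlucky_choices j X = (\<Prod>c\<in>B j - X. u j - u (barrier B j c - 1) - 1)"

text \<open>
  Prescribing the lucky cars leaves a product set: a lucky car has the single preference \<open>u j\<close>, and
  for an unlucky one this preference is struck out.
\<close>

lemma card_fixed_lucky_blocks:
  assumes L: "L \<in> (\<Pi>\<^sub>E j\<in>{1..r}. Pow (B j))"
  shows "card {a \<in> (\<Pi>\<^sub>E c\<in>cars. acceptable (block_of c) c). lucky_blocks a = L} =
    (\<Prod>j=1..r. unlucky_choices j (L j))"
proof -
  define Q where "Q = (\<lambda>j c. if c \<in> L j then {u j} else acceptable j c - {u j})"
  have lucky_iff: "lucky_blocks a = L \<longleftrightarrow>
      (\<forall>c\<in>cars. a c = u (block_of c) \<longleftrightarrow> c \<in> L (block_of c))" for a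
  proof -
    have "lucky_blocks a = L \<longleftrightarrow> (\<forall>j\<in>{1..r}. lucky_blocks a j = L j)"
      using L by (intro extensional_eq_iff lucky_blocks_extensional) (simp add: PiE_iff)
    also have "\<dots> \<longleftrightarrow> (\<forall>j\<in>{1..r}. \<forall>c\<in>B j. a c = u j \<longleftrightarrow> c \<in> L j)"
    proof (rule ball_cong[OF refl])
      fix j assume j: "j \<in> {1..r}"
      then have "L j \<subseteq> B j" using L by blast
      then show "lucky_blocks a j = L j \<longleftrightarrow> (\<forall>c\<in>B j. a c = u j \<longleftrightarrow> c \<in> L j)"
        unfolding lucky_blocks_def restrict_apply'[OF j] by blast
    qed
    finally show ?thesis using all_cars_iff[of "\<lambda>c j. a c = u j \<longleftrightarrow> c \<in> L j"] by blast
  qed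
  have Q_iff: "x \<in> Q (block_of c) c \<longleftrightarrow>
      x \<in> acceptable (block_of c) c \<and> (x = u (block_of c) \<longleftrightarrow> c \<in> L (block_of c))"
    if "c \<in> cars" for c x
    using spot_acceptable block_ofE[OF that] unfolding Q_def by auto
  have "{a \<in> (\<Pi>\<^sub>E c\<in>cars. acceptable (block_of c) c). lucky_blocks a = L} =
      (\<Pi>\<^sub>E c\<in>cars. Q (block_of c) c)"
    by (rule set_eqI) (use Q_iff in \<open>simp only: mem_Collect_eq lucky_iff PiE_iff, blast\<close>)
  also have "card \<dots> = (\<Prod>c\<in>cars. card (Q (block_of c) c))"
    by (rule card_PiE) simp
  also have "\<dots> = (\<Prod>j\<in>{1..r}. \<Prod>c\<in>B j. card (Q (block_of c) c))"
    unfolding block_union[symmetric] using finite_block block_disjoint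
    by (intro prod.UNION_disjoint) (auto simp: disjoint_family_on_def)
  also have "\<dots> = (\<Prod>j=1..r. unlucky_choices j (L j))"
  proof (rule prod.cong[OF refl])
    fix j assume j: "j \<in> {1..r}"
    have sub: "L j \<subseteq> B j" using L j by auto
    have "(\<Prod>c\<in>B j. card (Q (block_of c) c)) = (\<Prod>c\<in>B j. card (Q j c))"
      using block_of_eq[OF j] by simp
    also have "\<dots> = (\<Prod>c\<in>B j - L j. card (Q j c)) * (\<Prod>c\<in>L j. card (Q j c))"
      by (rule prod.subset_diff[OF sub finite_block[OF j]])
    also have "(\<Prod>c\<in>L j. card (Q j c)) = 1" by (simp add: Q_def)
    also have "(\<Prod>c\<in>B j - L j. card (Q j c)) = unlucky_choices j (L j)"
      unfolding unlucky_choices_def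
    proof (rule prod.cong[OF refl])
      fix c assume "c \<in> B j - L j"
      then have "Q j c = {u (barrier B j c - 1)<..<u j}"
        by (auto simp: Q_def acceptable_def)
      then show "card (Q j c) = u j - u (barrier B j c - 1) - 1" by simp
    qed
    finally show "(\<Prod>c\<in>B j. card (Q (block_of c) c)) = unlucky_choices j (L j)" by simp
  qed
  finally show ?thesis .
qed

text \<open>
  The parking functions are sorted by the numbers \<open>\<kappa> j\<close> of lucky cars in the blocks, and then by
  the sets \<open>L j\<close> themselves. The factor of block \<open>j\<close> depends on \<open>L j\<close> alone, so that
  \<open>prod_sum_PiE\<close> turns the sum over \<open>L\<close> into a product over the blocks.
\<close>

lemma card_with_outcome:
  "card {a \<in> parking_functions us. outcome r u m a = B \<and> card (lucky_cars us a) = k} =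
   (\<Sum>\<kappa> \<in> {\<kappa> \<in> (\<Pi>\<^sub>E i\<in>{1..r}. {0..m i}). (\<Sum>i=1..r. \<kappa> i) = k}.
      \<Prod>j=1..r. \<Sum>X \<in> {X. X \<subseteq> B j \<and> card X = \<kappa> j}. unlucky_choices j X)"
proof -
  let ?F = "\<Pi>\<^sub>E c\<in>cars. acceptable (block_of c) c"
  let ?K = "{\<kappa> \<in> (\<Pi>\<^sub>E i\<in>{1..r}. {0..m i}). (\<Sum>i=1..r. \<kappa> i) = k}"
  let ?S = "{a \<in> ?F. (\<Sum>j=1..r. card (lucky_blocks a j)) = k}"
  let ?Ls = "\<lambda>\<kappa>. \<Pi>\<^sub>E j\<in>{1..r}. {X. X \<subseteq> B j \<and> card X = \<kappa> j}"
  define counts where "counts a = (\<lambda>j\<in>{1..r}. card (lucky_blocks a j))" for a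
  have finF: "finite ?F" by (intro finite_PiE) (auto simp: acceptable_def)
  have finS: "finite ?S" using finF by simp
  have finK: "finite ?K" by (rule finite_subset[OF _ finite_PiE[of "{1..r}" "\<lambda>i. {0..m i}"]]) auto
  have sub: "lucky_blocks a j \<subseteq> B j" if "j \<in> {1..r}" for a j
    using that by (auto simp: lucky_blocks_def)
  have le: "card (lucky_blocks a j) \<le> m j" if "j \<in> {1..r}" for a j
    using card_mono[OF finite_block sub] card_block that by metis
  have S: "{a \<in> parking_functions us. outcome r u m a = B \<and> card (lucky_cars us a) = k} = ?S"
    using card_lucky_cars by (subst parking_functions_with_outcome[symmetric]) auto
  have "card ?S = (\<Sum>\<kappa>\<in>?K. card {a \<in> ?S. counts a = \<kappa>})"
  proof -
    have "counts ` ?S \<subseteq> ?K" using le by (auto simp: counts_def)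
    from sum.group[OF finS finK this, of "\<lambda>_. 1::nat"] show ?thesis by simp
  qed
  also have "\<dots> = (\<Sum>\<kappa>\<in>?K. \<Sum>L\<in>?Ls \<kappa>. card {a \<in> ?F. lucky_blocks a = L})"
  proof (rule sum.cong[OF refl])
    fix \<kappa> assume \<kappa>: "\<kappa> \<in> ?K"
    let ?T = "{a \<in> ?S. counts a = \<kappa>}"
    have "(\<Sum>j=1..r. card (lucky_blocks a j)) = k" if "counts a = \<kappa>" for a
    proof -
      have "(\<Sum>j=1..r. card (lucky_blocks a j)) = (\<Sum>j=1..r. counts a j)"
        unfolding counts_def by (intro sum.cong refl) (simp only: restrict_apply')
      then show ?thesis using \<kappa> that by simp
    qed
    then have T: "?T = {a \<in> ?F. counts a = \<kappa>}" by blast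
    have iff: "counts a = \<kappa> \<longleftrightarrow> lucky_blocks a \<in> ?Ls \<kappa>" for a
    proof -
      have "counts a = \<kappa> \<longleftrightarrow> (\<forall>j\<in>{1..r}. card (lucky_blocks a j) = \<kappa> j)"
        using \<kappa> extensional_eq_iff[of "counts a" "{1..r}" \<kappa>] by (simp add: counts_def PiE_iff)
      then show ?thesis using sub lucky_blocks_extensional by (simp add: PiE_iff)
    qed
    have "finite ?T" by (rule finite_subset[OF _ finS]) blast
    moreover have "finite (?Ls \<kappa>)" using finite_block by (intro finite_PiE) auto
    moreover have "lucky_blocks ` ?T \<subseteq> ?Ls \<kappa>" using iff by blast
    ultimately have "card ?T = (\<Sum>L\<in>?Ls \<kappa>. card {a \<in> ?T. lucky_blocks a = L})"
      using sum.group[of ?T "?Ls \<kappa>" lucky_blocks "\<lambda>_. 1::nat"] by simp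
    also have "\<dots> = (\<Sum>L\<in>?Ls \<kappa>. card {a \<in> ?F. lucky_blocks a = L})"
    proof (rule sum.cong[OF refl])
      fix L assume "L \<in> ?Ls \<kappa>"
      then have "{a \<in> ?T. lucky_blocks a = L} = {a \<in> ?F. lucky_blocks a = L}"
        unfolding T using iff by blast
      then show "card {a \<in> ?T. lucky_blocks a = L} = card {a \<in> ?F. lucky_blocks a = L}"
        by (rule arg_cong)
    qed
    finally show "card ?T = \<dots>" .
  qed
  also have "\<dots> = (\<Sum>\<kappa>\<in>?K. \<Sum>L\<in>?Ls \<kappa>. \<Prod>j=1..r. unlucky_choices j (L j))"
    by (intro sum.cong refl card_fixed_lucky_blocks) (auto simp: PiE_iff)
  also have "\<dots> = (\<Sum>\<kappa>\<in>?K. \<Prod>j=1..r. \<Sum>X \<in> {X. X \<subseteq> B j \<and> card X = \<kappa> j}. unlucky_choices j X)"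
    using finite_block by (intro sum.cong refl prod_sum_PiE[symmetric]) auto
  finally show ?thesis unfolding S .
qed


section \<open>The exponents\<close>

text \<open>
  The three clauses in the definition of \<open>ell\<close> are one formula: no car has barrier 0, all barriers
  in block \<open>j\<close> are at most \<open>j\<close>, and in between a car enters after the last car of the blocks
  \<open>t, \<dots>, j - 1\<close> if and only if its barrier is at most \<open>t\<close>. The maximum in the last case is that
  of a nonempty finite set because the blocks are nonempty.
\<close>

lemma ell_eq_card_barrier:
  assumes j: "j \<in> {1..r}" and t: "t \<le> j"
  shows "ell B L j t = card {c \<in> B j - L j. barrier B j c \<le> t}"
proof -
  have bounds: "1 \<le> barrier B j c" "barrier B j c \<le> j" for c
    using barrier_bounds j by auto
  consider "t = 0" | "t = j" "t \<noteq> 0" | "1 \<le> t" "t < j" using t by linarith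
  then show ?thesis
  proof cases
    case 1
    then have empty: "{c \<in> B j - L j. barrier B j c \<le> t} = {}"
      using bounds(1) by (metis (mono_tags, lifting) Collect_empty_eq le_0_eq not_one_le_zero)
    show ?thesis unfolding empty using 1 by (simp add: ell_def)
  next
    case 2
    then have "{c \<in> B j - L j. barrier B j c \<le> t} = B j - L j" using bounds(2) by blast
    then show ?thesis using 2 by (simp add: ell_def)
  next
    case 3
    let ?U = "\<Union>d\<in>{t..<j}. B d"
    have fin: "finite ?U" using finite_block j 3 by auto
    have "B t \<noteq> {}" using block_nonempty j 3 by auto
    then have ne: "?U \<noteq> {}" using 3 by auto
    have "Max ?U < c \<longleftrightarrow> barrier B j c \<le> t" for c
      using barrier_le_iff[of t j B c] 3 Max_less_iff[OF fin ne] by auto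
    then show ?thesis using 3 by (simp add: ell_def)
  qed
qed

text \<open>
  The exponent at \<open>t\<close> is the number of unlucky cars of block \<open>j\<close> with barrier \<open>t\<close>, each of which
  has \<open>u j - u (t - 1) - 1\<close> choices.
\<close>

lemma prod_ell_eq_unlucky_choices:
  assumes j: "j \<in> {1..r}"
  shows "(\<Prod>t=1..j. (u j - u (t - 1) - 1) ^ (ell B L j t - ell B L j (t - 1))) =
    unlucky_choices j (L j)"
proof -
  let ?U = "B j - L j"
  have fin: "finite ?U" using finite_block[OF j] by simp
  have diff: "ell B L j t - ell B L j (t - 1) = card {c \<in> ?U. barrier B j c = t}"
    if t: "t \<in> {1..j}" for t
  proof -
    have t_only: "{c \<in> ?U. barrier B j c = t} =
        {c \<in> ?U. barrier B j c \<le> t} - {c \<in> ?U. barrier B j c \<le> t - 1}"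
      using t by auto
    have "card {c \<in> ?U. barrier B j c = t} =
        card {c \<in> ?U. barrier B j c \<le> t} - card {c \<in> ?U. barrier B j c \<le> t - 1}"
      unfolding t_only by (intro card_Diff_subset finite_subset[OF _ fin]) auto
    also have "\<dots> = ell B L j t - ell B L j (t - 1)"
      using ell_eq_card_barrier[OF j, of t L] ell_eq_card_barrier[OF j, of "t - 1" L] t
      by (simp add: le_diff_conv)
    finally show ?thesis by (rule sym)
  qed
  have "(\<Prod>t=1..j. (u j - u (t - 1) - 1) ^ (ell B L j t - ell B L j (t - 1))) =
      (\<Prod>t=1..j. \<Prod>c\<in>{c \<in> ?U. barrier B j c = t}. u j - u (barrier B j c - 1) - 1)"
    by (rule prod.cong[OF refl]) (subst diff, assumption, simp)
  also have "\<dots> = (\<Prod>c\<in>?U. u j - u (barrier B j c - 1) - 1)"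
    using fin barrier_bounds j by (intro prod.group) auto
  finally show ?thesis unfolding unlucky_choices_def .
qed

lemma lucky_weight_eq:
  "lucky_weight r u B \<kappa> =
    (\<Prod>j=2..r. \<Sum>X \<in> {X. X \<subseteq> B j \<and> card X = \<kappa> j}. unlucky_choices j X)"
proof -
  have "lucky_weight r u B \<kappa> = (\<Sum>L \<in> (\<Pi>\<^sub>E d\<in>{2..r}. {X. X \<subseteq> B d \<and> card X = \<kappa> d}).
      \<Prod>j=2..r. unlucky_choices j (L j))"
    unfolding lucky_weight_def by (intro sum.cong prod.cong refl prod_ell_eq_unlucky_choices) auto
  also have "\<dots> = (\<Prod>j=2..r. \<Sum>X \<in> {X. X \<subseteq> B j \<and> card X = \<kappa> j}. unlucky_choices j X)"
    using finite_block by (intro prod_sum_PiE[symmetric]) auto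
  finally show ?thesis .
qed

lemma first_block_choices:
  assumes "1 \<le> r"
  shows "(\<Sum>X \<in> {X. X \<subseteq> B 1 \<and> card X = i}. unlucky_choices 1 X) =
    (m 1 choose i) * (u 1 - 1) ^ (m 1 - i)"
proof -
  have 1: "1 \<in> {1..r}" using assms by simp
  have "barrier B 1 c = 1" for c using barrier_bounds[of 1 B c] by simp
  then have "unlucky_choices 1 X = (u 1 - 1) ^ (m 1 - i)" if "X \<subseteq> B 1" "card X = i" for X
    using that card_Diff_subset[of X "B 1"] finite_subset[OF _ finite_block[OF 1]] card_block[OF 1]
    by (simp add: unlucky_choices_def u_0)
  then show ?thesis
    using n_subsets[OF finite_block[OF 1]] card_block[OF 1] by simp
qed

lemma card_with_outcome_lucky_weight:
  assumes "1 \<le> r"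
  shows "card {a \<in> parking_functions us. outcome r u m a = B \<and> card (lucky_cars us a) = k} =
   (\<Sum>\<kappa> \<in> {\<kappa> \<in> (\<Pi>\<^sub>E i\<in>{1..r}. {0..m i}). (\<Sum>i=1..r. \<kappa> i) = k}.
      (m 1 choose \<kappa> 1) * (u 1 - 1) ^ (m 1 - \<kappa> 1) * lucky_weight r u B \<kappa>)"
  unfolding card_with_outcome lucky_weight_eq first_block_choices[OF assms, symmetric]
  using assms by (intro sum.cong refl) (simp add: prod.atLeast_Suc_atMost numeral_2_eq_2)

end


section \<open>Counting over all outcomes\<close>

text \<open>
  That the blocks of an outcome have exactly the sizes \<open>m j\<close> follows by counting: no spot holds
  more cars than its capacity, and the number of cars equals the total capacity, so that no place
  is left empty when all cars park.
\<close>

lemma outcome_blocks_outcome: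
  assumes "u 0 = 0" "strict_mono_on {0..r} u" "\<forall>j\<in>{1..r}. 1 \<le> m j"
    and a: "a \<in> parking_functions (capacity_vector r u m)"
  shows "outcome_blocks r u m (outcome r u m a)"
proof -
  let ?us = "capacity_vector r u m" and ?n = "\<Sum>j=1..r. m j" and ?B = "outcome r u m a"
  have inj: "inj_on u {1..r}"
    by (rule inj_on_subset[OF strict_mono_on_imp_inj_on[OF assms(2)]]) auto
  have B: "?B j = {c \<in> {1..?n}. parking ?us a ?n c = Some (u j)}" if "j \<in> {1..r}" for j
    using that by (simp add: outcome_def Let_def length_capacity_vector)
  have fin: "finite (?B j)" if "j \<in> {1..r}" for j using B[OF that] by simp
  have union: "(\<Union>j\<in>{1..r}. ?B j) = {1..?n}"
  proof
    show "(\<Union>j\<in>{1..r}. ?B j) \<subseteq> {1..?n}" using B by auto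
    show "{1..?n} \<subseteq> (\<Union>j\<in>{1..r}. ?B j)"
    proof
      fix c assume c: "c \<in> {1..?n}"
      then have "parking ?us a ?n c \<noteq> None"
        using a by (simp add: parking_functions_def length_capacity_vector)
      then obtain p where p: "parking ?us a ?n c = Some p" by blast
      then have "p \<in> u ` {1..r}"
        using parking_spot_available count_list_capacity_vector_unavailable by metis
      then show "c \<in> (\<Union>j\<in>{1..r}. ?B j)" using p c B by blast
    qed
  qed
  have disj: "disjoint_family_on ?B {1..r}"
    unfolding disjoint_family_on_def
  proof (intro ballI impI)
    fix i j assume ij: "i \<in> {1..r}" "j \<in> {1..r}" "i \<noteq> j"
    then have "u i \<noteq> u j" using inj_onD[OF inj] by blast
    then show "?B i \<inter> ?B j = {}" unfolding B[OF ij(1)] B[OF ij(2)] by auto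
  qed
  have le: "card (?B j) \<le> m j" if j: "j \<in> {1..r}" for j
  proof -
    have "card (?B j) \<le> card {c. parking ?us a ?n c = Some (u j)}"
      using finite_parked B[OF j] by (intro card_mono) auto
    also have "\<dots> \<le> m j"
      using parking_capacity[of ?us a ?n "u j"] count_list_capacity_vector_spot[OF inj j] by simp
    finally show ?thesis .
  qed
  have "(\<Sum>j=1..r. card (?B j)) = card (\<Union>j\<in>{1..r}. ?B j)"
    using fin disj by (intro card_UN_disjoint[symmetric]) (auto simp: disjoint_family_on_def)
  then have total: "(\<Sum>j=1..r. card (?B j)) = ?n" using union by simp
  have "card (?B j) = m j" if j: "j \<in> {1..r}" for j
  proof (rule ccontr)
    assume "card (?B j) \<noteq> m j"
    then have "(\<Sum>j=1..r. card (?B j)) < ?n"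
      using le j by (intro sum_strict_mono_ex1) (auto intro!: bexI[of _ j] simp: le_neq_implies_less)
    then show False using total by simp
  qed
  then show ?thesis
    using assms union disj by unfold_locales (auto simp: outcome_def Let_def)
qed

theorem theorem5p11:
  fixes r k :: nat and u m :: "nat \<Rightarrow> nat"
  assumes "r \<ge> 1"
    and "u 0 = 0"
    and "1 \<le> u 1"
    and "strict_mono_on {1..r} u"
    and "\<forall>j\<in>{1..r}. 1 \<le> m j"
  shows
    "card (\<Union>I \<in> {I. I \<subseteq> {1..\<Sum>j=1..r. m j} \<and> card I = k}. LuckyPF (capacity_vector r u m) I) =
     (\<Sum>\<kappa> \<in> {\<kappa> \<in> (\<Pi>\<^sub>E i\<in>{1..r}. {0..m i}). (\<Sum>i=1..r. \<kappa> i) = k}.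
        \<Sum>B \<in> outcomes r u m.
          (m 1 choose \<kappa> 1) * (u 1 - 1) ^ (m 1 - \<kappa> 1) * lucky_weight r u B \<kappa>)"
proof -
  let ?us = "capacity_vector r u m"
  let ?PF = "parking_functions ?us"
  let ?A = "{a \<in> ?PF. card (lucky_cars ?us a) = k}"
  have mono: "strict_mono_on {0..r} u"
  proof (rule strict_mono_onI)
    fix i j assume ij: "i \<in> {0..r}" "j \<in> {0..r}" "i < j"
    have "u 1 \<le> u j"
      using strict_mono_on_leD[OF assms(4), of 1 j] ij by auto
    then show "u i < u j"
      using ij assms(2,3) strict_mono_onD[OF assms(4), of i j] by (cases "i = 0") auto
  qed
  have blocks: "outcome_blocks r u m B" if "B \<in> outcomes r u m" for B
    using that outcome_blocks_outcome[OF assms(2) mono assms(5)] by (auto simp: outcomes_def)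
  have fin_outcomes: "finite (outcomes r u m)"
  proof (rule finite_subset)
    show "outcomes r u m \<subseteq> (\<Pi>\<^sub>E j\<in>{1..r}. Pow {1..length ?us})"
      by (auto simp: outcomes_def outcome_def Let_def)
  qed (auto intro: finite_PiE)
  \<comment> \<open>Finiteness of the set of parking functions is obtained from the product description of
    its parts, as preferences range over an infinite set.\<close>
  have "finite {a \<in> ?PF. outcome r u m a = B}" if "B \<in> outcomes r u m" for B
    unfolding outcome_blocks.parking_functions_with_outcome[OF blocks[OF that]]
    by (intro finite_PiE) (auto simp: outcome_blocks.acceptable_def[OF blocks[OF that]])
  moreover have "?PF = (\<Union>B\<in>outcomes r u m. {a \<in> ?PF. outcome r u m a = B})"
    by (auto simp: outcomes_def)
  ultimately have "finite ?PF" using fin_outcomes by (metis (no_types, lifting) finite_UN_I)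
  then have fin: "finite ?A" by simp
  have "(\<Union>I \<in> {I. I \<subseteq> {1..\<Sum>j=1..r. m j} \<and> card I = k}. LuckyPF ?us I) = ?A"
    by (auto simp: LuckyPF_def lucky_cars_def length_capacity_vector)
  moreover have "card ?A = (\<Sum>B\<in>outcomes r u m. card {a \<in> ?A. outcome r u m a = B})"
  proof -
    have "outcome r u m ` ?A \<subseteq> outcomes r u m" by (auto simp: outcomes_def)
    from sum.group[OF fin fin_outcomes this, of "\<lambda>_. 1::nat"] show ?thesis by simp
  qed
  moreover have "\<dots> = (\<Sum>B \<in> outcomes r u m.
      \<Sum>\<kappa> \<in> {\<kappa> \<in> (\<Pi>\<^sub>E i\<in>{1..r}. {0..m i}). (\<Sum>i=1..r. \<kappa> i) = k}.
          (m 1 choose \<kappa> 1) * (u 1 - 1) ^ (m 1 - \<kappa> 1) * lucky_weight r u B \<kappa>)"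
  proof (rule sum.cong[OF refl])
    fix B assume "B \<in> outcomes r u m"
    note count = outcome_blocks.card_with_outcome_lucky_weight[OF blocks[OF this] assms(1), of k]
    have "{a \<in> ?A. outcome r u m a = B} =
        {a \<in> ?PF. outcome r u m a = B \<and> card (lucky_cars ?us a) = k}" by auto
    then show "card {a \<in> ?A. outcome r u m a = B} =
        (\<Sum>\<kappa> \<in> {\<kappa> \<in> (\<Pi>\<^sub>E i\<in>{1..r}. {0..m i}). (\<Sum>i=1..r. \<kappa> i) = k}.
          (m 1 choose \<kappa> 1) * (u 1 - 1) ^ (m 1 - \<kappa> 1) * lucky_weight r u B \<kappa>)"
      using count by simp
  qed
  moreover have "\<dots> = (\<Sum>\<kappa> \<in> {\<kappa> \<in> (\<Pi>\<^sub>E i\<in>{1..r}. {0..m i}). (\<Sum>i=1..r. \<kappa> i) = k}.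
      \<Sum>B \<in> outcomes r u m.
          (m 1 choose \<kappa> 1) * (u 1 - 1) ^ (m 1 - \<kappa> 1) * lucky_weight r u B \<kappa>)"
    by (rule sum.swap)
  ultimately show ?thesis by (simp only:)
qed

end
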